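(* Let $d\ge 1$ and let $n,a_1,\ldots,a_d$ be positive integers. If $(n,a_1,\ldots,a_d)\xrightarrow{\textsc{bm}} m$, then $(n;a_1,\ldots,a_d)\xrightarrow{\textsc{ad}} m$. In other words, $\textsc{ad}(n;a_1,\ldots,a_d)\ge \textsc{bm}(n,a_1,\ldots,a_d)$.
   Context: Hypergraph notions. A hypergraph is identified with its (finite) edge set; a matching is a set of pairwise disjoint edges, and $\nu(H)$ is the maximum size of a matching. A hypergraph $H$ is $k$-partite with sides $V_1,\ldots,V_k$ (a fixed partition of its vertex set) if $|e\cap V_t|=1$ for every edge $e$ and every $t$. For $f:H\to\mathbb{R}_{\ge 0}$ and a vertex $v$, $\deg_f(v)=\sum_{e\ni v}f(e)$; $f$ is balanced if $\deg_f$ is constant on each side $V_t$. $H$ is $(b_1,\ldots,b_k)$-fractionally balanced if it is $k$-partite with sides of sizes $b_1,\ldots,b_k$ and admits a nonzero balanced function $f:H\to\mathbb{R}_{\ge0}$. We write $(b_1,\ldots,b_k)\xrightarrow{\textsc{bm}} m$ if every $(b_1,\ldots,b_k)$-fractionally balanced $k$-partite hypergraph has a matching of size $m$, and $\textsc{bm}(b_1,\ldots,b_k)$ is the largest such $m$. Admissible division. Let $\Delta_{a-1}=\{x\in\mathbb{R}^a_{\ge0}:\sum_i x_i=1\}$ and $\mathcal{P}=\prod_{t=1}^d\Delta_{a_t-1}$; a point $P=(P^1,\ldots,P^d)\in\mathcal{P}$ represents a division of $d$ cakes (copies of $[0,1]$), cake $t$ being cut into $a_t$ consecutive slices of lengths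 $P^t_1,\ldots,P^t_{a_t}$ (left to right). Let $\mathcal{J}=[a_1]\times\cdots\times[a_d]$; $\vec j=(j_1,\ldots,j_d)$ denotes the $d$-tuple consisting of slice $j_t$ of cake $t$ for each $t$. An instance with $n$ agents consists of, for each agent $i\in[n]$, a map $L^i$ assigning to every $P\in\mathcal{P}$ a set $L^i(P)\subseteq\mathcal{J}$ such that (i) for each $\vec j\in\mathcal{J}$ the set $\{P\in\mathcal{P}:\vec j\in L^i(P)\}$ is closed, and (ii) for every $P$ there is $\vec j\in L^i(P)$ with $P^t_{j_t}>0$ for all $t\in[d]$. For $P\in\mathcal{P}$, $\nu^D(P)$ is the largest size of a set $Q\subseteq[n]$ for which there is $\phi:Q\to\mathcal{J}$ with $\phi(q)\in L^q(P)$ for all $q\in Q$ and such that for distinct $q,q'\in Q$ the vectors $\phi(q),\phi(q')$ differ in every coordinate. We write $(n;a_1,\ldots,a_d)\xrightarrow{\textsc{ad}} m$ if for every instance with $n$ agents there exists $P\in\mathcal{P}$ with $\nu^D(P)\ge m$; $\textsc{ad}(n;a_1,\ldots,a_d)$ is the largest such $m$. *)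

theory Defs
  imports "HOL-Analysis.Analysis" "HOL-Homology.Simplices"
begin

text \<open>
  A \<open>k\<close>-tuple of positive integers is a list of length \<open>k\<close>. All indices (sides, cakes, slices,
  agents) are counted from \<open>0\<close>.
\<close>

definition is_matching :: "'v set set \<Rightarrow> bool" where
  "is_matching M \<longleftrightarrow> (\<forall>e\<in>M. \<forall>e'\<in>M. e \<noteq> e' \<longrightarrow> e \<inter> e' = {})"

definition has_matching :: "'v set set \<Rightarrow> nat \<Rightarrow> bool" where
  "has_matching H m \<longleftrightarrow> (\<exists>M\<subseteq>H. is_matching M \<and> card M = m)"

definition k_partite :: "nat \<Rightarrow> (nat \<Rightarrow> 'v set) \<Rightarrow> 'v set set \<Rightarrow> bool" where
  "k_partite k V H \<longleftrightarrow>
     disjoint_family_on V {..<k} \<and>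
     (\<forall>e\<in>H. e \<subseteq> (\<Union>t<k. V t) \<and> (\<forall>t<k. card (e \<inter> V t) = 1))"

definition wdeg :: "'v set set \<Rightarrow> ('v set \<Rightarrow> real) \<Rightarrow> 'v \<Rightarrow> real" where
  "wdeg H f v = (\<Sum>e | e \<in> H \<and> v \<in> e. f e)"

definition balanced :: "nat \<Rightarrow> (nat \<Rightarrow> 'v set) \<Rightarrow> 'v set set \<Rightarrow> ('v set \<Rightarrow> real) \<Rightarrow> bool" where
  "balanced k V H f \<longleftrightarrow> (\<forall>t<k. \<exists>c. \<forall>v\<in>V t. wdeg H f v = c)"

definition fractionally_balanced :: "nat list \<Rightarrow> (nat \<Rightarrow> 'v set) \<Rightarrow> 'v set set \<Rightarrow> bool" where
  "fractionally_balanced b V H \<longleftrightarrow>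
     finite H \<and>
     k_partite (length b) V H \<and>
     (\<forall>t<length b. finite (V t) \<and> card (V t) = b ! t) \<and>
     (\<exists>f. (\<forall>e\<in>H. 0 \<le> f e) \<and> (\<exists>e\<in>H. f e \<noteq> 0) \<and> balanced (length b) V H f)"

text \<open>
  The hypergraphs have finitely many vertices, so nothing is lost by taking the vertices to be
  natural numbers; lemma \<open>bm_arrow_any_type\<close> below makes this precise.
\<close>

definition bm_arrow :: "nat list \<Rightarrow> nat \<Rightarrow> bool" where
  "bm_arrow b m \<longleftrightarrow>
     (\<forall>(V :: nat \<Rightarrow> nat set) H. fractionally_balanced b V H \<longrightarrow> has_matching H m)"

definition bm :: "nat list \<Rightarrow> nat" where
  "bm b = (GREATEST m. bm_arrow b m)"

lemma bm_arrow_any_type: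
  fixes V :: "nat \<Rightarrow> 'v set"
  assumes arrow: "bm_arrow b m" and fb: "fractionally_balanced b V H"
  shows "has_matching H m"
proof -
  let ?k = "length b"
  define U where "U = (\<Union>t<?k. V t)"
  have finV: "\<And>t. t < ?k \<Longrightarrow> finite (V t)" and cardV: "\<And>t. t < ?k \<Longrightarrow> card (V t) = b ! t"
    and disj: "disjoint_family_on V {..<?k}" and finH: "finite H"
    and HU: "\<And>e. e \<in> H \<Longrightarrow> e \<subseteq> U"
    and H1: "\<And>e t. e \<in> H \<Longrightarrow> t < ?k \<Longrightarrow> card (e \<inter> V t) = 1"
    using fb unfolding fractionally_balanced_def k_partite_def U_def by auto
  have VU: "\<And>t. t < ?k \<Longrightarrow> V t \<subseteq> U" unfolding U_def by blast
  have "finite U" unfolding U_def using finV by blast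
  then obtain h :: "'v \<Rightarrow> nat" where h: "inj_on h U"
    using finite_imp_inj_to_nat_seg[of U] by blast
  define g where "g = inv_into U h"
  have gh: "g ` h ` e = e" if "e \<subseteq> U" for e
    unfolding g_def using h that by (rule inv_into_image_cancel)
  obtain f where f0: "\<forall>e\<in>H. 0 \<le> f e" and f1: "\<exists>e\<in>H. f e \<noteq> 0" and fb': "balanced ?k V H f"
    using fb unfolding fractionally_balanced_def by blast
  define V' where "V' t = h ` V t" for t
  define H' where "H' = (`) h ` H"
  define f' where "f' e = f (g ` e)" for e
  have fh: "f' (h ` e) = f e" if "e \<in> H" for e
    unfolding f'_def using gh[OF HU[OF that]] by simp
  have injH: "inj_on ((`) h) H"
  proof (rule inj_onI)
    fix e e' assume e: "e \<in> H" "e' \<in> H" and eq: "h ` e = h ` e'"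
    have "e = g ` h ` e" by (rule gh[OF HU[OF e(1)], symmetric])
    also have "\<dots> = g ` h ` e'" by (simp only: eq)
    also have "\<dots> = e'" by (rule gh[OF HU[OF e(2)]])
    finally show "e = e'" .
  qed
  have int: "h ` A \<inter> h ` B = h ` (A \<inter> B)" if "A \<subseteq> U" "B \<subseteq> U" for A B
    using inj_on_image_Int[OF h that] by simp
  have deg: "wdeg H' f' (h v) = wdeg H f v" if "v \<in> U" for v
  proof -
    have "{e. e \<in> H' \<and> h v \<in> e} = (`) h ` {e. e \<in> H \<and> v \<in> e}"
    proof -
      have "h v \<in> h ` e \<longleftrightarrow> v \<in> e" if "e \<in> H" for e
        using inj_on_image_mem_iff[OF h \<open>v \<in> U\<close> HU[OF that]] .
      then show ?thesis unfolding H'_def by blast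
    qed
    moreover have "inj_on ((`) h) {e. e \<in> H \<and> v \<in> e}"
      using injH by (rule inj_on_subset) auto
    ultimately show ?thesis
      unfolding wdeg_def by (simp add: sum.reindex fh)
  qed
  have "fractionally_balanced b V' H'"
    unfolding fractionally_balanced_def
  proof (intro conjI exI[of _ f'])
    show "finite H'" unfolding H'_def using finH by simp
    have "disjoint_family_on V' {..<?k}"
      unfolding disjoint_family_on_def V'_def
    proof (intro ballI impI)
      fix s t assume st: "s \<in> {..<?k}" "t \<in> {..<?k}" "s \<noteq> t"
      then have "V s \<inter> V t = {}" using disj unfolding disjoint_family_on_def by blast
      then show "h ` V s \<inter> h ` V t = {}" using int[OF VU VU, of s t] st by simp
    qed
    moreover have "e \<subseteq> (\<Union>t<?k. V' t)" if "e \<in> H'" for e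
    proof -
      obtain e0 where e0: "e0 \<in> H" "e = h ` e0" using \<open>e \<in> H'\<close> unfolding H'_def by blast
      then have "e \<subseteq> h ` U" using HU by blast
      then show ?thesis unfolding U_def V'_def by blast
    qed
    moreover have "card (e \<inter> V' t) = 1" if "e \<in> H'" "t < ?k" for e t
    proof -
      obtain e0 where e0: "e0 \<in> H" "e = h ` e0" using \<open>e \<in> H'\<close> unfolding H'_def by blast
      have "e \<inter> V' t = h ` (e0 \<inter> V t)"
        unfolding V'_def e0(2) by (rule int[OF HU[OF e0(1)] VU[OF that(2)]])
      moreover have "inj_on h (e0 \<inter> V t)"
        using h by (rule inj_on_subset) (use HU e0 in blast)
      ultimately show ?thesis using H1[OF e0(1) that(2)] by (simp add: card_image)
    qed
    ultimately show "k_partite ?k V' H'" unfolding k_partite_def by blast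
    show "\<forall>t<?k. finite (V' t) \<and> card (V' t) = b ! t"
      unfolding V'_def using finV cardV card_image[OF inj_on_subset[OF h VU]] by simp
    show "\<forall>e\<in>H'. 0 \<le> f' e" unfolding H'_def using f0 fh by auto
    show "\<exists>e\<in>H'. f' e \<noteq> 0" unfolding H'_def using f1 fh by auto
    have deg': "\<forall>v\<in>V' t. wdeg H' f' v = c" if "t < ?k" "\<forall>v\<in>V t. wdeg H f v = c" for t c
    proof
      fix w assume "w \<in> V' t"
      then obtain v where v: "v \<in> V t" "w = h v" unfolding V'_def by blast
      then have "v \<in> U" using VU[OF that(1)] by blast
      then show "wdeg H' f' w = c" using deg v that(2) by simp
    qed
    show "balanced ?k V' H' f'"
      unfolding balanced_def
    proof (intro allI impI)
      fix t assume t: "t < ?k"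
      then obtain c where "\<forall>v\<in>V t. wdeg H f v = c" using fb' unfolding balanced_def by blast
      then show "\<exists>c. \<forall>v\<in>V' t. wdeg H' f' v = c" by (intro exI deg'[OF t])
    qed
  qed
  then have "has_matching H' m" using arrow unfolding bm_arrow_def by blast
  then obtain M where M: "M \<subseteq> H" "is_matching ((`) h ` M)" "card ((`) h ` M) = m"
    unfolding has_matching_def H'_def subset_image_iff by blast
  have injM: "inj_on ((`) h) M" using injH M(1) by (rule inj_on_subset)
  have "is_matching M"
    unfolding is_matching_def
  proof (intro ballI impI)
    fix e e' assume e: "e \<in> M" "e' \<in> M" "e \<noteq> e'"
    then have "h ` e \<noteq> h ` e'" using injM by (auto dest: inj_onD)
    then have "h ` e \<inter> h ` e' = {}" using M(2) e(1,2) unfolding is_matching_def by simp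
    then show "e \<inter> e' = {}" by auto
  qed
  moreover have "card M = m" using M(3) injM by (simp add: card_image)
  ultimately show ?thesis unfolding has_matching_def using M(1) by blast
qed

text \<open>
  For \<open>a > 0\<close>, the simplex with \<open>a\<close> vertices is \<open>standard_simplex (a - 1)\<close>, whose points are the
  functions on \<open>nat\<close> that vanish from index \<open>a\<close> on. The topology on divisions is that of the
  function space \<open>nat \<Rightarrow> nat \<Rightarrow> real\<close>, i.e. the product topology; all coordinates that do not
  belong to a slice of a cake are constant on \<open>divisions a\<close>.
\<close>

definition divisions :: "nat list \<Rightarrow> (nat \<Rightarrow> nat \<Rightarrow> real) set" where
  "divisions a = (\<Pi>\<^sub>E t\<in>{..<length a}. standard_simplex (a ! t - 1))"

definition slice_tuples :: "nat list \<Rightarrow> (nat \<Rightarrow> nat) set" where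
  "slice_tuples a = (\<Pi>\<^sub>E t\<in>{..<length a}. {..<a ! t})"

definition ad_instance ::
    "nat \<Rightarrow> nat list \<Rightarrow> (nat \<Rightarrow> (nat \<Rightarrow> nat \<Rightarrow> real) \<Rightarrow> (nat \<Rightarrow> nat) set) \<Rightarrow> bool" where
  "ad_instance n a L \<longleftrightarrow>
     (\<forall>i<n.
        (\<forall>P\<in>divisions a. L i P \<subseteq> slice_tuples a) \<and>
        (\<forall>j\<in>slice_tuples a.
           closedin (top_of_set (divisions a)) {P \<in> divisions a. j \<in> L i P}) \<and>
        (\<forall>P\<in>divisions a. \<exists>j\<in>L i P. \<forall>t<length a. P t (j t) > 0))"

definition nuD ::
    "nat \<Rightarrow> nat list \<Rightarrow> (nat \<Rightarrow> (nat \<Rightarrow> nat \<Rightarrow> real) \<Rightarrow> (nat \<Rightarrow> nat) set) \<Rightarrow>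
     (nat \<Rightarrow> nat \<Rightarrow> real) \<Rightarrow> nat" where
  "nuD n a L P =
     Max {card Q |Q. Q \<subseteq> {..<n} \<and>
       (\<exists>\<phi>. (\<forall>q\<in>Q. \<phi> q \<in> L q P) \<and>
            (\<forall>q\<in>Q. \<forall>q'\<in>Q. q \<noteq> q' \<longrightarrow> (\<forall>t<length a. \<phi> q t \<noteq> \<phi> q' t)))}"

definition ad_arrow :: "nat \<Rightarrow> nat list \<Rightarrow> nat \<Rightarrow> bool" where
  "ad_arrow n a m \<longleftrightarrow>
     (\<forall>L. ad_instance n a L \<longrightarrow> (\<exists>P\<in>divisions a. nuD n a L P \<ge> m))"

definition ad :: "nat \<Rightarrow> nat list \<Rightarrow> nat" where
  "ad n a = (GREATEST m. ad_arrow n a m)"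

end

theory Submission
  imports Defs
begin

text \<open>
  It suffices to find a division \<open>P\<close> at which the hypergraph of all pairs (agent, acceptable slice
  tuple) carries a balanced weight function. Replace each agent's list by a continuous probability
  distribution on the tuples that have no empty slice and are acceptable at some division within
  \<open>\<epsilon>\<close> of \<open>P\<close>. Averaging the marginals over the agents gives a self-map of the product of simplices
  that preserves faces, so by Brouwer's theorem it attains the barycentre; there the distributions
  form a balanced weight function. Compactness removes the \<open>\<epsilon>\<close>. Brouwer's theorem is proved for cubes
  in function spaces, from Kuhn's lemma, because the dimension is not a type here.
\<close>

section \<open>Compactness and convergence in function spaces\<close>

text \<open>Outside \<open>I\<close> every member takes the value \<open>undefined\<close>, so
  \<open>PiE I S\<close> is a product over all indices with singleton factors there, and Tychonoff
  applies.\<close>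

lemma compact_PiE_fun:
  fixes S :: "'i \<Rightarrow> 'a::topological_space set"
  assumes "\<And>i. i \<in> I \<Longrightarrow> compact (S i)"
  shows "compact (PiE I S)"
proof -
  define T where "T i = (if i \<in> I then S i else {undefined})" for i
  have "PiE I S = PiE UNIV T"
    unfolding T_def by (fastforce simp: PiE_def extensional_def Pi_def split: if_splits)
  moreover have "compactin (product_topology (\<lambda>i. euclidean) UNIV) (PiE UNIV T)"
    using assms by (auto simp: compactin_PiE T_def)
  ultimately show ?thesis
    by (simp add: euclidean_product_topology)
qed

lemma tendsto_fun_iff:
  fixes f :: "'b \<Rightarrow> 'i \<Rightarrow> 'a::topological_space"
  shows "(f \<longlongrightarrow> l) F \<longleftrightarrow> (\<forall>i. ((\<lambda>x. f x i) \<longlongrightarrow> l i) F)"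
  using limitin_componentwise[of "\<lambda>i::'i. euclidean :: 'a topology" UNIV f l F]
  by (simp add: euclidean_product_topology)

section \<open>Brouwer's theorem for cubes\<close>

text \<open>The combinatorial half of Brouwer's theorem. Kuhn's lemma on the grid of mesh
  \<open>1 / p\<close> gives a cell in which, for every coordinate, both labels occur; the corners
  \<open>y\<close> and \<open>z\<close> carrying them vary with the coordinate
  \<open>i\<close>.\<close>

lemma brouwer_cube_approx:
  fixes g :: "('i \<Rightarrow> real) \<Rightarrow> 'i \<Rightarrow> real" and I :: "'i set" and p :: nat
  defines "C \<equiv> PiE I (\<lambda>_. {0..1})"
  assumes "finite I" and g01: "\<And>x i. x \<in> C \<Longrightarrow> i \<in> I \<Longrightarrow> g x i \<in> {0..1}" and p: "0 < p"
  shows "\<exists>x\<in>C. \<forall>i\<in>I. \<exists>y\<in>C. \<exists>z\<in>C.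
    (\<forall>j\<in>I. \<bar>y j - x j\<bar> \<le> 1 / p \<and> \<bar>z j - x j\<bar> \<le> 1 / p) \<and> y i \<le> g y i \<and> g z i \<le> z i"
proof -
  define n where "n = card I"
  obtain e where e: "bij_betw e {..<n} I"
    using ex_bij_betw_nat_finite[OF \<open>finite I\<close>] by (auto simp: n_def atLeast0LessThan)
  define h where "h = inv_into {..<n} e"
  have h: "h i < n" "e (h i) = i" if "i \<in> I" for i
    using e that bij_betw_inv_into_right[OF e that] bij_betwE[OF bij_betw_inv_into[OF e]]
    by (auto simp: h_def)
  have eh: "e k \<in> I" "h (e k) = k" if "k < n" for k
    using e that by (auto simp: h_def bij_betw_def)
  define pt :: "(nat \<Rightarrow> nat) \<Rightarrow> 'i \<Rightarrow> real" where "pt v = (\<lambda>i\<in>I. v (h i) / p)" for v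
  have pt: "pt v \<in> C" if "\<forall>i<n. v i \<le> p" for v
    using that h p by (auto simp: C_def pt_def divide_simps)
  \<comment> \<open>Kuhn's lemma wants label 1 on the whole face \<open>v k = p\<close>, even where
    \<open>g\<close> fixes that coordinate, hence the first conjunct. This is harmless: there
    \<open>pt v\<close> has coordinate 1, which bounds \<open>g\<close> from above.\<close>
  define label :: "(nat \<Rightarrow> nat) \<Rightarrow> nat \<Rightarrow> nat"
    where "label v k = (if v k \<noteq> p \<and> pt v (e k) \<le> g (pt v) (e k) then 0 else 1)" for v k
  have lab0: "pt v i \<le> g (pt v) i" if "label v (h i) = 0" "i \<in> I" for v i
    using that h by (auto simp: label_def split: if_splits)
  have lab1: "g (pt v) i \<le> pt v i" if "label v (h i) \<noteq> 0" "i \<in> I" "\<forall>i<n. v i \<le> p" for v i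
    using that h g01[OF pt that(2), of v] p by (auto simp: label_def pt_def split: if_splits)
  have k0: "\<forall>x. (\<forall>i<n. x i \<le> p) \<longrightarrow> (\<forall>i<n. x i = 0 \<longrightarrow> label x i = 0)"
    using p g01[OF pt] eh by (auto simp: label_def pt_def)
  have k1: "\<forall>x. (\<forall>i<n. x i \<le> p) \<longrightarrow> (\<forall>i<n. label x i = 0 \<or> label x i = 1)"
    "\<forall>x. (\<forall>i<n. x i \<le> p) \<longrightarrow> (\<forall>i<n. x i = p \<longrightarrow> label x i = 1)"
    by (auto simp: label_def)
  obtain q where q: "\<forall>i<n. q i < p" and
    rs: "\<forall>i<n. \<exists>r s. (\<forall>j<n. q j \<le> r j \<and> r j \<le> q j + 1) \<and> (\<forall>j<n. q j \<le> s j \<and> s j \<le> q j + 1)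
       \<and> label r i \<noteq> label s i"
    using kuhn_lemma[OF p k1(1) k0 k1(2)] by blast
  show ?thesis
  proof (rule bexI[of _ "pt q"], rule ballI)
    show "pt q \<in> C" using q by (intro pt) auto
    fix i assume i: "i \<in> I"
    have near: "\<forall>j<n. r j \<le> p" "\<forall>j\<in>I. \<bar>pt r j - pt q j\<bar> \<le> 1 / p"
      if "\<forall>j<n. q j \<le> r j \<and> r j \<le> q j + 1" for r
    proof -
      show "\<forall>j<n. r j \<le> p" using that q by force
      show "\<forall>j\<in>I. \<bar>pt r j - pt q j\<bar> \<le> 1 / p"
      proof
        fix j assume j: "j \<in> I"
        have "real (q (h j)) \<le> r (h j)" "real (r (h j)) \<le> q (h j) + 1"
          using that h(1)[OF j] by (auto simp flip: of_nat_Suc)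
        then show "\<bar>pt r j - pt q j\<bar> \<le> 1 / p"
          using j p by (auto simp: pt_def simp flip: diff_divide_distrib intro!: divide_right_mono)
      qed
    qed
    obtain r s where r: "\<forall>j<n. q j \<le> r j \<and> r j \<le> q j + 1"
      and s: "\<forall>j<n. q j \<le> s j \<and> s j \<le> q j + 1" and ne: "label r (h i) \<noteq> label s (h i)"
      using rs h(1)[OF i] by blast
    \<comment> \<open>Kuhn's lemma only says that the labels differ; swapping \<open>r\<close> and
      \<open>s\<close> if necessary puts label 0 first.\<close>
    have "label r (h i) = 0 \<and> label s (h i) \<noteq> 0 \<or> label s (h i) = 0 \<and> label r (h i) \<noteq> 0"
      using ne by (auto simp: label_def split: if_splits)
    with r s have "\<exists>r s. (\<forall>j<n. q j \<le> r j \<and> r j \<le> q j + 1) \<and>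
        (\<forall>j<n. q j \<le> s j \<and> s j \<le> q j + 1) \<and> label r (h i) = 0 \<and> label s (h i) \<noteq> 0"
      by blast
    then obtain r s where "\<forall>j<n. q j \<le> r j \<and> r j \<le> q j + 1" "\<forall>j<n. q j \<le> s j \<and> s j \<le> q j + 1"
      "label r (h i) = 0" "label s (h i) \<noteq> 0" by blast
    with near[of r] near[of s] lab0[OF _ i] lab1[OF _ i] pt
    show "\<exists>y\<in>C. \<exists>z\<in>C. (\<forall>j\<in>I. \<bar>y j - pt q j\<bar> \<le> 1 / p \<and> \<bar>z j - pt q j\<bar> \<le> 1 / p)
      \<and> y i \<le> g y i \<and> g z i \<le> z i"
      by (intro bexI[of _ "pt r"] bexI[of _ "pt s"]) auto
  qed
qed

text \<open>The mesh tends to 0. A subsequence of the base points \<open>X k\<close> converges, the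
  companions \<open>Y k i\<close> and \<open>Z k i\<close> converge along it to the same limit, and
  continuity turns their opposite inequalities into an equation. The class \<open>countable\<close>
  makes the function space metric, so that compactness yields sequences.\<close>

lemma brouwer_cube_fun:
  fixes g :: "('i::countable \<Rightarrow> real) \<Rightarrow> 'i \<Rightarrow> real" and I :: "'i set"
  defines "C \<equiv> PiE I (\<lambda>_. {0..1})"
  assumes "finite I" and cont: "\<And>i. i \<in> I \<Longrightarrow> continuous_on C (\<lambda>x. g x i)"
    and g01: "\<And>x i. x \<in> C \<Longrightarrow> i \<in> I \<Longrightarrow> g x i \<in> {0..1}"
  obtains x where "x \<in> C" "\<And>i. i \<in> I \<Longrightarrow> g x i = x i"
proof -
  have "\<forall>k. \<exists>x\<in>C. \<forall>i\<in>I. \<exists>y\<in>C. \<exists>z\<in>C.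
    (\<forall>j\<in>I. \<bar>y j - x j\<bar> \<le> 1 / Suc k \<and> \<bar>z j - x j\<bar> \<le> 1 / Suc k) \<and> y i \<le> g y i \<and> g z i \<le> z i"
    using brouwer_cube_approx[OF \<open>finite I\<close>, of g] g01 unfolding C_def by blast
  then obtain X where X: "\<And>k. X k \<in> C" and YZ: "\<And>k i. i \<in> I \<Longrightarrow> \<exists>y\<in>C. \<exists>z\<in>C.
    (\<forall>j\<in>I. \<bar>y j - X k j\<bar> \<le> 1 / Suc k \<and> \<bar>z j - X k j\<bar> \<le> 1 / Suc k) \<and> y i \<le> g y i \<and> g z i \<le> z i"
    by metis
  have "\<forall>k. \<forall>i\<in>I. \<exists>y. y \<in> C \<and> (\<forall>j\<in>I. \<bar>y j - X k j\<bar> \<le> 1 / Suc k) \<and> y i \<le> g y i"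
    using YZ by blast
  then obtain Y where Y: "\<And>k i. i \<in> I \<Longrightarrow>
      Y k i \<in> C \<and> (\<forall>j\<in>I. \<bar>Y k i j - X k j\<bar> \<le> 1 / Suc k) \<and> Y k i i \<le> g (Y k i) i"
    by metis
  have "\<forall>k. \<forall>i\<in>I. \<exists>z. z \<in> C \<and> (\<forall>j\<in>I. \<bar>z j - X k j\<bar> \<le> 1 / Suc k) \<and> g z i \<le> z i"
    using YZ by blast
  then obtain Z where Z: "\<And>k i. i \<in> I \<Longrightarrow>
      Z k i \<in> C \<and> (\<forall>j\<in>I. \<bar>Z k i j - X k j\<bar> \<le> 1 / Suc k) \<and> g (Z k i) i \<le> Z k i i"
    by metis
  have "compact C" unfolding C_def by (rule compact_PiE_fun) simp
  then obtain x r where x: "x \<in> C" "strict_mono r" "(X \<circ> r) \<longlonglongrightarrow> x"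
    using X unfolding compact_eq_seq_compact_metric seq_compact_def by blast
  have conv: "(\<lambda>k. W (r k)) \<longlonglongrightarrow> x"
    if W: "\<And>k. W k \<in> C" "\<And>k j. j \<in> I \<Longrightarrow> \<bar>W k j - X k j\<bar> \<le> 1 / Suc k" for W
    unfolding tendsto_fun_iff
  proof
    fix j
    show "(\<lambda>k. W (r k) j) \<longlonglongrightarrow> x j"
    proof (cases "j \<in> I")
      case True
      have "(\<lambda>k. 1 / real (Suc (r k))) \<longlonglongrightarrow> 0"
        using LIMSEQ_subseq_LIMSEQ[OF lim_inverse_n' x(2)] x(2)
          LIMSEQ_subseq_LIMSEQ[OF LIMSEQ_Suc[OF lim_inverse_n'] x(2)] by (simp add: o_def)
      then have "(\<lambda>k. W (r k) j - X (r k) j) \<longlonglongrightarrow> 0"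
        by (rule Lim_null_comparison[rotated]) (use W(2)[OF True] in auto)
      moreover have "(\<lambda>k. X (r k) j) \<longlonglongrightarrow> x j"
        using x(3) by (simp add: tendsto_fun_iff o_def)
      ultimately show ?thesis using tendsto_add by fastforce
    next
      case False
      then have "W (r k) j = x j" for k
        using W(1)[of "r k"] x(1) by (auto simp: C_def PiE_def extensional_def)
      then show ?thesis by simp
    qed
  qed
  have "g x i = x i" if i: "i \<in> I" for i
  proof (rule antisym)
    have lim: "(\<lambda>k. g (W (r k)) i) \<longlonglongrightarrow> g x i" if "(\<lambda>k. W (r k)) \<longlonglongrightarrow> x" "\<And>k. W k \<in> C" for W
      using continuous_on_tendsto_compose[OF cont[OF i] that(1) x(1)] that(2) by simp
    have "(\<lambda>k. Z (r k) i) \<longlonglongrightarrow> x" using Z[OF i] by (intro conv) auto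
    then show "g x i \<le> x i"
      using lim[of "\<lambda>k. Z k i"] Z[OF i]
      by (intro LIMSEQ_le[of "\<lambda>k. g (Z (r k) i) i" _ "\<lambda>k. Z (r k) i i"]) (auto simp: tendsto_fun_iff)
    have "(\<lambda>k. Y (r k) i) \<longlonglongrightarrow> x" using Y[OF i] by (intro conv) auto
    then show "x i \<le> g x i"
      using lim[of "\<lambda>k. Y k i"] Y[OF i]
      by (intro LIMSEQ_le[of "\<lambda>k. Y (r k) i i" _ "\<lambda>k. g (Y (r k) i) i"]) (auto simp: tendsto_fun_iff)
  qed
  with x(1) show thesis using that by blast
qed

section \<open>Simplices and divisions\<close>

lemma standard_simplex_sum:
  assumes "k > 0"
  shows "x \<in> standard_simplex (k - 1) \<longleftrightarrow>
    (\<forall>s. 0 \<le> x s) \<and> (\<forall>s\<ge>k. x s = 0) \<and> (\<Sum>s<k. x s) = 1"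
proof -
  have eq: "{..k - 1} = {..<k}" using assms by auto
  have le1: "x s \<le> 1" if "\<forall>s. 0 \<le> x s" "\<forall>s\<ge>k. x s = 0" "(\<Sum>s<k. x s) = 1" for s
    using that member_le_sum[of s "{..<k}" x] by (cases "s < k") auto
  have "(\<forall>s>k - 1. x s = 0) \<longleftrightarrow> (\<forall>s\<ge>k. x s = 0)"
    using assms by (metis Suc_diff_1 Suc_le_eq)
  then show ?thesis unfolding standard_simplex_def eq mem_Collect_eq using le1 by blast
qed

lemma divisions_iff:
  assumes "\<forall>t<length a. a ! t > 0"
  shows "P \<in> divisions a \<longleftrightarrow> P \<in> extensional {..<length a} \<and>
    (\<forall>t<length a. (\<forall>s. 0 \<le> P t s) \<and> (\<forall>s\<ge>a ! t. P t s = 0) \<and> (\<Sum>s<a ! t. P t s) = 1)"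
proof -
  have "P \<in> divisions a \<longleftrightarrow>
      P \<in> extensional {..<length a} \<and> (\<forall>t<length a. P t \<in> standard_simplex (a ! t - 1))"
    unfolding divisions_def PiE_def Pi_def by blast
  then show ?thesis using assms standard_simplex_sum by simp
qed

lemma compact_standard_simplex: "compact (standard_simplex p)"
proof -
  have "closed (standard_simplex p)"
    using closedin_standard_simplex[of p] by (simp add: euclidean_product_topology)
  moreover have "compact (UNIV \<rightarrow>\<^sub>E {0..1::real} :: (nat \<Rightarrow> real) set)"
    by (rule compact_PiE_fun) simp
  ultimately show ?thesis
    using standard_simplex_01[of p] by (metis compact_Int_closed inf.absorb_iff2)
qed

lemma compact_divisions: "compact (divisions a)"
  unfolding divisions_def by (intro compact_PiE_fun compact_standard_simplex)

section \<open>Face-preserving maps reach the barycentre\<close>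

text \<open>By \<open>fixpt\<close>, \<open>p\<close> times the total deficit is the deficit of
  \<open>f\<close> below \<open>1 / k\<close>. If the total were positive, each \<open>s\<close>
  with \<open>p s > 0\<close> would have \<open>f s < 1 / k\<close>, and each other \<open>s\<close>
  has \<open>f s = 0\<close>; then \<open>f\<close> would sum to less than 1. So there is no
  deficit, and the sum 1 excludes any excess.\<close>

lemma equalized_of_fixed_point:
  fixes p f :: "nat \<Rightarrow> real" and k :: nat
  assumes p: "\<And>s. s < k \<Longrightarrow> 0 \<le> p s"
    and f: "(\<Sum>s<k. f s) = 1" and face: "\<And>s. s < k \<Longrightarrow> p s = 0 \<Longrightarrow> f s = 0"
    and fixpt: "\<And>s. s < k \<Longrightarrow> p s * (\<Sum>r<k. max 0 (1 / k - f r)) = max 0 (1 / k - f s)"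
    and s: "s < k"
  shows "f s = 1 / k"
proof -
  let ?S = "\<Sum>r<k. max 0 (1 / k - f r)"
  have S0: "?S \<ge> 0" by (intro sum_nonneg) auto
  have const: "(\<Sum>r<k. 1 / real k) = 1" using s by simp
  have le: "1 / k \<le> f r" if r: "r < k" for r
  proof (rule ccontr)
    assume "\<not> 1 / k \<le> f r"
    then have "p r * ?S > 0" using fixpt[OF r] by simp
    then have "?S > 0" using S0 by (cases "?S = 0") auto
    have "f q < 1 / k" if q: "q < k" for q
    proof (cases "p q = 0")
      case True
      then show ?thesis using face[OF q] q by simp
    next
      case False
      then have "p q * ?S > 0" using p[OF q] \<open>?S > 0\<close> by simp
      then show ?thesis using fixpt[OF q] by (simp add: max_def split: if_splits)
    qed
    then have "(\<Sum>q<k. f q) < (\<Sum>q<k. 1 / real k)"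
      using s by (intro sum_strict_mono) auto
    then show False using f const by simp
  qed
  show ?thesis
  proof (rule ccontr)
    assume "f s \<noteq> 1 / k"
    then have "(\<Sum>q<k. 1 / real k) < (\<Sum>q<k. f q)"
      using le s by (intro sum_strict_mono_ex1) force+
    then show False using f const by simp
  qed
qed

text \<open>
  A fixed point of \<open>P \<mapsto> (P + max 0 (1/k - F P)) / (normalisation)\<close> is mapped to the
  barycentre by \<open>F\<close>, since a coordinate with \<open>P = 0\<close> has \<open>F P = 0 < 1/k\<close> and would be increased.
\<close>

lemma face_preserving_hits_barycentre:
  fixes F :: "(nat \<Rightarrow> nat \<Rightarrow> real) \<Rightarrow> nat \<Rightarrow> nat \<Rightarrow> real"
  assumes pos: "\<forall>t<length a. a ! t > 0"
    and cont: "\<And>t s. t < length a \<Longrightarrow> s < a ! t \<Longrightarrow> continuous_on (divisions a) (\<lambda>P. F P t s)"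
    and sum1: "\<And>P t. P \<in> divisions a \<Longrightarrow> t < length a \<Longrightarrow> (\<Sum>s<a ! t. F P t s) = 1"
    and face: "\<And>P t s. P \<in> divisions a \<Longrightarrow> t < length a \<Longrightarrow> s < a ! t \<Longrightarrow> P t s = 0 \<Longrightarrow> F P t s = 0"
  obtains P where "P \<in> divisions a" "\<And>t s. t < length a \<Longrightarrow> s < a ! t \<Longrightarrow> F P t s = 1 / real (a ! t)"
proof -
  define I where "I = Sigma {..<length a} (\<lambda>t. {..<a ! t})"
  define C :: "(nat \<times> nat \<Rightarrow> real) set" where "C = PiE I (\<lambda>_. {0..1})"
  define S :: "(nat \<times> nat \<Rightarrow> real) \<Rightarrow> nat \<Rightarrow> real" where "S x t = (\<Sum>s<a ! t. x (t, s))" for x t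
  \<comment> \<open>\<open>R\<close> retracts the cube onto \<open>divisions a\<close>; dividing by \<open>S x t\<close> alone would be discontinuous at \<open>0\<close>.\<close>
  define R where "R x = (\<lambda>t\<in>{..<length a}. \<lambda>s.
    if s < a ! t then (x (t, s) + max 0 (1 - S x t) / real (a ! t)) / max 1 (S x t) else 0)" for x
  define E where "E P t = (\<Sum>s<a ! t. max 0 (1 / real (a ! t) - F P t s))" for P t
  \<comment> \<open>Each row of \<open>R x\<close> sums to 1, so \<open>1 + E (R x) t\<close> is the
    sum of the numerators in row \<open>t\<close>, and the rows of \<open>g x\<close> sum to 1
    again.\<close>
  define g where "g x = (\<lambda>(t, s). (R x t s + max 0 (1 / real (a ! t) - F (R x) t s)) / (1 + E (R x) t))" for x
  have "finite I" unfolding I_def by auto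
  have RD: "R x \<in> divisions a" if x: "x \<in> C" for x
    unfolding divisions_iff[OF pos]
  proof (intro conjI allI impI)
    show "R x \<in> extensional {..<length a}" by (simp add: R_def)
    fix t assume t: "t < length a"
    have x0: "0 \<le> x (t, s)" if "s < a ! t" for s
      using x t that by (auto simp: C_def I_def PiE_def Pi_def)
    show "0 \<le> R x t s" for s using t x0 by (auto simp: R_def)
    show "R x t s = 0" if "a ! t \<le> s" for s using t that by (auto simp: R_def)
    \<comment> \<open>The shortfall is spread evenly over the row, and
      \<open>S + max 0 (1 - S) = max 1 S\<close>.\<close>
    have "(\<Sum>s<a ! t. R x t s) = (S x t + max 0 (1 - S x t)) / max 1 (S x t)"
      using t pos by (simp add: R_def sum.distrib S_def flip: sum_divide_distrib)
    also have "\<dots> = 1" by (auto simp: max_def)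
    finally show "(\<Sum>s<a ! t. R x t s) = 1" .
  qed
  have E0: "0 \<le> E P t" for P t unfolding E_def by (intro sum_nonneg) auto
  have contx: "continuous_on C (\<lambda>x. x i)" for i
    by (rule continuous_on_subset[OF continuous_on_product_coordinates]) simp
  have contR: "continuous_on C R"
  proof (rule continuous_on_coordinatewise_then_product)+
    fix t s
    have "continuous_on C (\<lambda>x. S x t)" unfolding S_def by (intro continuous_intros contx)
    then have "continuous_on C (\<lambda>x. (x (t, s) + max 0 (1 - S x t) / real (a ! t)) / max 1 (S x t))"
      if "t < length a"
      using that pos by (intro continuous_intros contx) (auto simp: max_def)
    then show "continuous_on C (\<lambda>x. R x t s)"
      by (cases "t < length a"; cases "s < a ! t") (simp_all add: R_def)
  qed
  have contF: "continuous_on C (\<lambda>x. F (R x) t s)" if "t < length a" "s < a ! t" for t s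
    using continuous_on_compose2[OF cont[OF that] contR] RD by auto
  have g0: "0 \<le> g x (t, s)" if "x \<in> C" "t < length a" "s < a ! t" for x t s
    using RD[OF that(1)] that E0[of "R x" t] by (auto simp: g_def divisions_iff[OF pos])
  have gsum: "(\<Sum>s<a ! t. g x (t, s)) = 1" if x: "x \<in> C" and t: "t < length a" for x t
    using RD[OF x] t E0[of "R x" t]
    by (simp add: g_def sum.distrib divisions_iff[OF pos] E_def flip: sum_divide_distrib)
  have g01: "g x i \<in> {0..1}" if x: "x \<in> C" and iI: "i \<in> I" for x i
  proof -
    obtain t s where i: "i = (t, s)" "t < length a" "s < a ! t"
      using iI by (auto simp: I_def)
    have "g x (t, s) \<le> (\<Sum>s<a ! t. g x (t, s))"
      using i g0[OF x] by (intro member_le_sum) auto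
    then show ?thesis using gsum[OF x i(2)] g0[OF x i(2,3)] i by simp
  qed
  have contg: "continuous_on C (\<lambda>x. g x i)" if iI: "i \<in> I" for i
  proof -
    obtain t s where i: "i = (t, s)" "t < length a" "s < a ! t"
      using iI by (auto simp: I_def)
    have "continuous_on C (\<lambda>x. R x t s)"
      by (rule continuous_on_product_then_coordinatewise[OF
            continuous_on_product_then_coordinatewise[OF contR]])
    moreover have "continuous_on C (\<lambda>x. E (R x) t)"
      unfolding E_def using i pos by (intro continuous_intros contF) auto
    moreover have "1 + E P t \<noteq> 0" for P using E0[of P t] by linarith
    ultimately show ?thesis
      unfolding g_def i(1) prod.case using i pos by (intro continuous_intros contF) auto
  qed
  obtain x where x: "x \<in> C" "\<And>i. i \<in> I \<Longrightarrow> g x i = x i"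
    using brouwer_cube_fun[OF \<open>finite I\<close>, of g] contg g01 unfolding C_def by blast
  have barycentre: "F (R x) t s = 1 / real (a ! t)" if t: "t < length a" and s: "s < a ! t" for t s
  proof (rule equalized_of_fixed_point[of "a ! t" "R x t" "F (R x) t"])
    have gx: "g x (t, s) = x (t, s)" if "s < a ! t" for s
      using t that by (intro x(2)) (auto simp: I_def)
    \<comment> \<open>The fixed point inherits row sum 1 from \<open>g\<close>. Hence the retraction
      does not move its row, and the equation for \<open>x\<close> becomes one for the division
      \<open>R x\<close>.\<close>
    have "S x t = 1" unfolding S_def using gsum[OF x(1) t] gx by simp
    then have Rx: "R x t s = x (t, s)" if "s < a ! t" for s using t that by (simp add: R_def)
    show "R x t s * (\<Sum>r<a ! t. max 0 (1 / real (a ! t) - F (R x) t r))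
        = max 0 (1 / real (a ! t) - F (R x) t s)" if "s < a ! t" for s
    proof -
      have "(R x t s + max 0 (1 / real (a ! t) - F (R x) t s)) / (1 + E (R x) t) = R x t s"
        using gx[OF that] Rx[OF that] by (simp add: g_def)
      then have "R x t s + max 0 (1 / real (a ! t) - F (R x) t s) = R x t s * (1 + E (R x) t)"
        using E0[of "R x" t] by (simp add: divide_eq_eq)
      then show ?thesis by (simp add: E_def algebra_simps)
    qed
    show "0 \<le> R x t s" for s using RD[OF x(1)] t by (auto simp: divisions_iff[OF pos])
    show "(\<Sum>s<a ! t. F (R x) t s) = 1" by (rule sum1[OF RD[OF x(1)] t])
    show "F (R x) t s = 0" if "s < a ! t" "R x t s = 0" for s by (rule face[OF RD[OF x(1)] t that])
  qed (rule s)
  show thesis by (rule that[OF RD[OF x(1)]]) (rule barycentre)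
qed

section \<open>Balanced weights on agents and slice tuples\<close>

text \<open>The agents have weight 1 each, so the total is \<open>n\<close>; equal degrees on the
  slices of cake \<open>t\<close> must then be \<open>n / a ! t\<close>.\<close>

definition balanced_weights ::
    "nat \<Rightarrow> nat list \<Rightarrow> (nat \<Rightarrow> (nat \<Rightarrow> nat) \<Rightarrow> real) \<Rightarrow> bool" where
  "balanced_weights n a w \<longleftrightarrow>
     (\<forall>i<n. \<forall>j\<in>slice_tuples a. 0 \<le> w i j) \<and>
     (\<forall>i<n. (\<Sum>j\<in>slice_tuples a. w i j) = 1) \<and>
     (\<forall>t<length a. \<forall>s<a ! t. (\<Sum>i<n. \<Sum>j | j \<in> slice_tuples a \<and> j t = s. w i j) = n / real (a ! t))"

lemma finite_slice_tuples: "finite (slice_tuples a)"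
  unfolding slice_tuples_def by (intro finite_PiE) auto

lemma sum_slice_tuples_by_coordinate:
  fixes w :: "(nat \<Rightarrow> nat) \<Rightarrow> real"
  assumes "t < length a"
  shows "(\<Sum>s<a ! t. \<Sum>j | j \<in> slice_tuples a \<and> j t = s. w j) = (\<Sum>j\<in>slice_tuples a. w j)"
  using assms by (intro sum.group finite_slice_tuples) (auto simp: slice_tuples_def)

text \<open>Acceptance jumps with \<open>P\<close>, so it is smoothed: a tuple receives weight
  according to how far \<open>P\<close> is, within \<epsilon>, from the closed set
  \<open>A i j\<close> where it is acceptable. Since \<open>infdist\<close> to the empty set is 0,
  tuples that are never acceptable have to be given weight 0 separately.\<close>

lemma approximate_balanced_weights:
  assumes pos: "\<forall>t<length a. a ! t > 0" and n: "n > 0" and inst: "ad_instance n a L"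
    and eps: "\<epsilon> > 0"
  obtains P w where "P \<in> divisions a" "balanced_weights n a w"
    "\<forall>i<n. \<forall>j\<in>slice_tuples a. w i j \<noteq> 0 \<longrightarrow>
       (\<exists>P'\<in>divisions a. j \<in> L i P' \<and> dist P P' < \<epsilon>)"
proof -
  let ?T = "slice_tuples a" and ?D = "divisions a"
  define A where "A i j = {P \<in> ?D. j \<in> L i P}" for i j
  \<comment> \<open>The product of slice lengths makes \<open>F\<close> below face-preserving.\<close>
  define u where "u P i j = (if A i j = {} then 0
    else max 0 (\<epsilon> - infdist P (A i j)) * (\<Prod>t<length a. P t (j t)))" for P i j
  define U where "U P i = (\<Sum>j\<in>?T. u P i j)" for P i
  define w where "w P i j = u P i j / U P i" for P i j
  \<comment> \<open>\<open>F P t\<close> averages the agents' marginals on cake \<open>t\<close>; it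
    is uniform for every \<open>t\<close> exactly when the slice degrees are balanced.\<close>
  define F where "F P t s = (\<Sum>i<n. \<Sum>j | j \<in> ?T \<and> j t = s. w P i j) / n" for P t s
  have u0: "0 \<le> u P i j" if "P \<in> ?D" for P i j
    using that by (auto simp: u_def divisions_iff[OF pos] intro!: mult_nonneg_nonneg prod_nonneg)
  have U0: "0 < U P i" if P: "P \<in> ?D" and i: "i < n" for P i
  proof -
    \<comment> \<open>Condition (ii) provides a tuple acceptable at \<open>P\<close> itself, hence
      at distance 0, with all slices nonempty; it keeps the normaliser positive.\<close>
    obtain j where j: "j \<in> L i P" "\<forall>t<length a. P t (j t) > 0" "j \<in> ?T"
      using inst i P unfolding ad_instance_def by blast
    have "P \<in> A i j" using P j by (simp add: A_def)
    then have "0 < u P i j" using j eps by (auto simp: u_def intro!: mult_pos_pos prod_pos)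
    then show ?thesis
      unfolding U_def using j(3) u0[OF P] finite_slice_tuples by (intro sum_pos2[of _ j]) auto
  qed
  have w1: "(\<Sum>j\<in>?T. w P i j) = 1" if "P \<in> ?D" "i < n" for P i
    using U0[OF that] by (simp add: w_def U_def flip: sum_divide_distrib)
  have contu: "continuous_on ?D (\<lambda>P. u P i j)" for i j
  proof -
    have "continuous_on ?D (\<lambda>P. P t (j t))" for t
      by (rule continuous_on_product_then_coordinatewise[OF
            continuous_on_product_then_coordinatewise[OF continuous_on_id]])
    then have "continuous_on ?D (\<lambda>P. max 0 (\<epsilon> - infdist P (A i j)) * (\<Prod>t<length a. P t (j t)))"
      by (intro continuous_intros)
    then show ?thesis by (cases "A i j = {}") (simp_all add: u_def)
  qed
  have contw: "continuous_on ?D (\<lambda>P. w P i j)" if "i < n" for i j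
    unfolding w_def U_def using U0[OF _ that]
    by (intro continuous_intros contu) (force simp: U_def)
  obtain P where P: "P \<in> ?D" "\<And>t s. t < length a \<Longrightarrow> s < a ! t \<Longrightarrow> F P t s = 1 / real (a ! t)"
  proof (rule face_preserving_hits_barycentre[OF pos, of F])
    show "continuous_on ?D (\<lambda>P. F P t s)" for t s
      unfolding F_def using n by (intro continuous_intros contw) auto
    show "(\<Sum>s<a ! t. F P t s) = 1" if P: "P \<in> ?D" and t: "t < length a" for P t
    proof -
      have "(\<Sum>s<a ! t. F P t s) = (\<Sum>i<n. \<Sum>s<a ! t. \<Sum>j | j \<in> ?T \<and> j t = s. w P i j) / n"
        unfolding F_def sum_divide_distrib[symmetric] by (subst sum.swap) simp
      then show ?thesis
        using n w1[OF P] by (simp add: sum_slice_tuples_by_coordinate[OF t])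
    qed
    show "F P t s = 0" if "t < length a" "P t s = 0" for P t s
    proof -
      have "(\<Prod>r<length a. P r (j r)) = 0" if "j t = s" for j
        using \<open>t < length a\<close> \<open>P t s = 0\<close> that by (auto intro: prod_zero)
      then show ?thesis by (auto simp: F_def w_def u_def intro!: sum.neutral)
    qed
  qed blast
  show thesis
  proof (rule that[OF P(1), of "w P"])
    have "(\<Sum>i<n. \<Sum>j | j \<in> ?T \<and> j t = s. w P i j) = n / real (a ! t)"
      if "t < length a" "s < a ! t" for t s
      using P(2)[OF that] n pos that by (simp add: F_def field_simps)
    then show "balanced_weights n a (w P)"
      unfolding balanced_weights_def using w1[OF P(1)] u0[OF P(1)] U0[OF P(1)]
      by (auto simp: w_def less_imp_le)
    have "\<exists>P'\<in>?D. j \<in> L i P' \<and> dist P P' < \<epsilon>" if "w P i j \<noteq> 0" for i j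
    proof -
      have "A i j \<noteq> {}" "infdist P (A i j) < \<epsilon>"
        using that by (auto simp: w_def u_def max_def split: if_splits)
      then obtain P' where "P' \<in> A i j" "dist P P' < \<epsilon>"
        by (auto simp: infdist_def cInf_less_iff)
      then show ?thesis by (auto simp: A_def)
    qed
    then show "\<forall>i<n. \<forall>j\<in>?T. w P i j \<noteq> 0 \<longrightarrow> (\<exists>P'\<in>?D. j \<in> L i P' \<and> dist P P' < \<epsilon>)"
      by blast
  qed
qed

text \<open>Being balanced does not refer to a division. The approximate weights can therefore be
  kept while the division is moved from \<open>P\<close> to a point \<open>P0\<close> whose
  neighbourhood \<open>N P0\<close> contains the \<epsilon>-ball about \<open>P\<close>. A single
  \<epsilon> suffices, with no limit of weights.\<close>

lemma exists_balanced_weights: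
  assumes pos: "\<forall>t<length a. a ! t > 0" and n: "n > 0" and inst: "ad_instance n a L"
  obtains P w where "P \<in> divisions a" "balanced_weights n a w"
    "\<forall>i<n. \<forall>j\<in>slice_tuples a. w i j \<noteq> 0 \<longrightarrow> j \<in> L i P"
proof -
  let ?T = "slice_tuples a" and ?D = "divisions a"
  define A where "A i j = {P \<in> ?D. j \<in> L i P}" for i j
  \<comment> \<open>The neighbourhood of \<open>P\<close> on which no agent accepts a tuple that it rejects at \<open>P\<close>; a Lebesgue
    number of this cover turns an approximate solution into an exact one.\<close>
  define N where "N P = - (\<Union>(i, j) \<in> {(i, j). i < n \<and> j \<in> ?T \<and> j \<notin> L i P}. A i j)" for P
  have closedA: "closed (A i j)" if "i < n" "j \<in> ?T" for i j
  proof (rule closedin_closed_trans)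
    show "closedin (top_of_set ?D) (A i j)"
      using inst that unfolding ad_instance_def A_def by blast
    show "closed ?D" using compact_divisions by (rule compact_imp_closed)
  qed
  have "open (N P)" for P
  proof -
    have "finite {(i, j). i < n \<and> j \<in> ?T \<and> j \<notin> L i P}"
      by (rule finite_subset[of _ "{..<n} \<times> ?T"]) (auto intro: finite_slice_tuples)
    then show ?thesis unfolding N_def by (intro open_Compl closed_UN) (auto intro: closedA)
  qed
  then have openN: "open G" if "G \<in> N ` ?D" for G using that by auto
  have coverN: "?D \<subseteq> \<Union> (N ` ?D)" by (auto simp: N_def A_def)
  have "\<exists>\<epsilon>>0. \<forall>P\<in>?D. \<exists>G\<in>N ` ?D. ball P \<epsilon> \<subseteq> G"
    by (rule Heine_Borel_lemma[OF compact_divisions coverN openN]) blast+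
  then obtain \<epsilon> where eps: "\<epsilon> > 0" "\<forall>P\<in>?D. \<exists>G\<in>N ` ?D. ball P \<epsilon> \<subseteq> G" by blast
  obtain P w where Pw: "P \<in> ?D" "balanced_weights n a w"
    "\<forall>i<n. \<forall>j\<in>?T. w i j \<noteq> 0 \<longrightarrow> (\<exists>P'\<in>?D. j \<in> L i P' \<and> dist P P' < \<epsilon>)"
    by (rule approximate_balanced_weights[OF pos n inst eps(1)])
  obtain P0 where P0: "P0 \<in> ?D" "ball P \<epsilon> \<subseteq> N P0" using eps(2) Pw(1) by blast
  have L0: "j \<in> L i P0" if ij: "i < n" "j \<in> ?T" "w i j \<noteq> 0" for i j
  proof -
    obtain P' where P': "P' \<in> ?D" "j \<in> L i P'" "dist P P' < \<epsilon>" using Pw(3) ij by blast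
    then have "P' \<in> N P0" using P0(2) by auto
    then show ?thesis using ij P' by (auto simp: N_def A_def)
  qed
  show thesis by (rule that[OF P0(1) Pw(2)]) (use L0 in blast)
qed

section \<open>The hypergraph of agents and slices\<close>

text \<open>Vertex \<open>(0, i)\<close> is agent \<open>i\<close>, and vertex \<open>(Suc t, s)\<close> is slice \<open>s\<close> of cake \<open>t\<close>.\<close>

definition agent_edge :: "nat \<Rightarrow> nat \<times> (nat \<Rightarrow> nat) \<Rightarrow> (nat \<times> nat) set" where
  "agent_edge d x = insert (0, fst x) ((\<lambda>t. (Suc t, snd x t)) ` {..<d})"

definition agent_side :: "nat \<Rightarrow> nat list \<Rightarrow> nat \<Rightarrow> (nat \<times> nat) set" where
  "agent_side n a k = {k} \<times> {..<(n # a) ! k}"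

lemma agent_edge_mem [simp]:
  "(0, i) \<in> agent_edge d x \<longleftrightarrow> i = fst x"
  "(Suc t, s) \<in> agent_edge d x \<longleftrightarrow> t < d \<and> s = snd x t"
  by (auto simp: agent_edge_def)

text \<open>An edge meets each side in one vertex, from which the agent and the tuple can be read
  off. Weights on pairs can thus be transported to edges without collisions.\<close>

lemma inj_on_agent_edge:
  "inj_on (agent_edge (length a)) ({..<n} \<times> slice_tuples a)"
proof (rule inj_onI, clarify)
  fix i j i' j'
  assume j: "j \<in> slice_tuples a" "j' \<in> slice_tuples a"
    and eq: "agent_edge (length a) (i, j) = agent_edge (length a) (i', j')"
  have "(0, i) \<in> agent_edge (length a) (i', j')" unfolding eq[symmetric] by simp
  then have "i = i'" by simp
  moreover have "j t = j' t" if "t < length a" for t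
  proof -
    have "(Suc t, j t) \<in> agent_edge (length a) (i', j')" unfolding eq[symmetric] using that by simp
    then show ?thesis by simp
  qed
  then have "j = j'" using j unfolding slice_tuples_def by (intro PiE_ext) auto
  ultimately show "i = i' \<and> j = j'" by simp
qed

text \<open>\<open>X\<close> is allowed to exceed the support of \<open>w\<close>, so that it can be
  the set of all acceptable pairs; the additional edges get weight 0.\<close>

lemma fractionally_balanced_agent_hypergraph:
  assumes n: "n > 0" and bal: "balanced_weights n a w"
    and X: "X \<subseteq> {..<n} \<times> slice_tuples a"
    and supp: "\<And>i j. i < n \<Longrightarrow> j \<in> slice_tuples a \<Longrightarrow> w i j \<noteq> 0 \<Longrightarrow> (i, j) \<in> X"
  shows "fractionally_balanced (n # a) (agent_side n a) (agent_edge (length a) ` X)"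
proof -
  let ?E = "agent_edge (length a)" and ?T = "slice_tuples a"
  let ?H = "?E ` X"
  define f where "f e = (let x = inv_into X ?E e in w (fst x) (snd x))" for e
  have injX: "inj_on ?E X" using inj_on_agent_edge X by (rule inj_on_subset)
  have fE: "f (?E x) = w (fst x) (snd x)" if "x \<in> X" for x
    using that injX by (simp add: f_def)
  have "finite X" using X by (rule finite_subset) (simp add: finite_slice_tuples)
  have deg: "wdeg ?H f v = (\<Sum>x | x \<in> {..<n} \<times> ?T \<and> v \<in> ?E x. w (fst x) (snd x))" for v
  proof -
    have "{e. e \<in> ?H \<and> v \<in> e} = ?E ` {x \<in> X. v \<in> ?E x}" by auto
    then have "wdeg ?H f v = (\<Sum>x\<in>{x \<in> X. v \<in> ?E x}. f (?E x))"
      unfolding wdeg_def using injX by (simp add: sum.reindex inj_on_subset)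
    also have "\<dots> = (\<Sum>x\<in>{x \<in> X. v \<in> ?E x}. w (fst x) (snd x))" by (simp add: fE)
    \<comment> \<open>Adding the pairs of weight 0 outside \<open>X\<close> makes the index set for
      each vertex a full product.\<close>
    also have "\<dots> = (\<Sum>x | x \<in> {..<n} \<times> ?T \<and> v \<in> ?E x. w (fst x) (snd x))"
      by (rule sum.mono_neutral_left) (use X supp finite_slice_tuples in auto)
    finally show ?thesis .
  qed
  have deg0: "wdeg ?H f (0, i) = 1" if "i < n" for i
  proof -
    have "{x. x \<in> {..<n} \<times> ?T \<and> (0, i) \<in> ?E x} = {i} \<times> ?T"
      using that by auto
    then have "wdeg ?H f (0, i) = (\<Sum>i\<in>{i}. \<Sum>j\<in>?T. w i j)"
      by (simp only: deg sum.cartesian_product case_prod_unfold)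
    then show ?thesis using bal that by (simp add: balanced_weights_def)
  qed
  have degS: "wdeg ?H f (Suc t, s) = n / real (a ! t)" if "t < length a" "s < a ! t" for t s
  proof -
    have "{x. x \<in> {..<n} \<times> ?T \<and> (Suc t, s) \<in> ?E x} = {..<n} \<times> {j. j \<in> ?T \<and> j t = s}"
      using that by auto
    then have "wdeg ?H f (Suc t, s) = (\<Sum>i<n. \<Sum>j | j \<in> ?T \<and> j t = s. w i j)"
      by (simp only: deg sum.cartesian_product case_prod_unfold)
    then show ?thesis using bal that by (simp add: balanced_weights_def)
  qed
  show ?thesis
    unfolding fractionally_balanced_def
  proof (intro conjI exI[of _ f])
    show "finite ?H" using \<open>finite X\<close> by simp
    show "\<forall>t<length (n # a). finite (agent_side n a t) \<and> card (agent_side n a t) = (n # a) ! t"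
      by (simp add: agent_side_def)
    show "\<forall>e\<in>?H. 0 \<le> f e"
    proof
      fix e assume "e \<in> ?H"
      then obtain x where x: "x \<in> X" "e = ?E x" by blast
      then have "fst x < n" "snd x \<in> ?T" using X by auto
      then show "0 \<le> f e" using bal fE x by (simp add: balanced_weights_def)
    qed
    have sides: "e \<subseteq> (\<Union>t<length (n # a). agent_side n a t) \<and>
        (\<forall>t<length (n # a). card (e \<inter> agent_side n a t) = 1)" if eH: "e \<in> ?H" for e
    proof -
      obtain i j where e: "e = ?E (i, j)" and i: "i < n" and j: "j \<in> ?T"
        using eH X by auto
      have jt: "j t < a ! t" if "t < length a" for t
        using j that by (auto simp: slice_tuples_def)
      have "e \<inter> agent_side n a t = {(t, (case t of 0 \<Rightarrow> i | Suc t \<Rightarrow> j t))}"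
        if "t < length (n # a)" for t
        using that i jt by (cases t) (auto simp: e agent_side_def)
      moreover have "e \<subseteq> (\<Union>t<length (n # a). agent_side n a t)"
        using i jt by (force simp: e agent_edge_def agent_side_def)
      ultimately show ?thesis by simp
    qed
    moreover have "disjoint_family_on (agent_side n a) {..<length (n # a)}"
      by (auto simp: disjoint_family_on_def agent_side_def)
    ultimately show "k_partite (length (n # a)) (agent_side n a) ?H"
      unfolding k_partite_def by blast
    \<comment> \<open>Agent 0 exists and has degree 1, so \<open>f\<close> cannot vanish.\<close>
    show "\<exists>e\<in>?H. f e \<noteq> 0"
    proof (rule ccontr)
      assume "\<not> ?thesis"
      then have "wdeg ?H f (0, 0) = 0" unfolding wdeg_def by (intro sum.neutral) auto
      then show False using deg0[OF n] by simp
    qed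
    show "balanced (length (n # a)) (agent_side n a) ?H f"
      unfolding balanced_def
    proof (intro allI impI)
      fix t assume "t < length (n # a)"
      then show "\<exists>c. \<forall>v\<in>agent_side n a t. wdeg ?H f v = c"
        using deg0 degS by (cases t) (auto simp: agent_side_def)
    qed
  qed
qed

section \<open>From matchings to agents served\<close>

definition nuD_sizes ::
    "nat \<Rightarrow> nat list \<Rightarrow> (nat \<Rightarrow> (nat \<Rightarrow> nat \<Rightarrow> real) \<Rightarrow> (nat \<Rightarrow> nat) set) \<Rightarrow>
     (nat \<Rightarrow> nat \<Rightarrow> real) \<Rightarrow> nat set" where
  "nuD_sizes n a L P = {card Q |Q. Q \<subseteq> {..<n} \<and>
       (\<exists>\<phi>. (\<forall>q\<in>Q. \<phi> q \<in> L q P) \<and>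
            (\<forall>q\<in>Q. \<forall>q'\<in>Q. q \<noteq> q' \<longrightarrow> (\<forall>t<length a. \<phi> q t \<noteq> \<phi> q' t)))}"

lemma nuD_eq_Max: "nuD n a L P = Max (nuD_sizes n a L P)"
  unfolding nuD_def nuD_sizes_def ..

lemma nuD_sizes_le:
  assumes "c \<in> nuD_sizes n a L P"
  shows "c \<le> n"
proof -
  obtain Q where "c = card Q" "Q \<subseteq> {..<n}" using assms unfolding nuD_sizes_def by blast
  then show ?thesis using card_mono[of "{..<n}" Q] by simp
qed

lemma finite_nuD_sizes: "finite (nuD_sizes n a L P)"
  by (rule finite_subset[of _ "{..n}"]) (auto dest: nuD_sizes_le)

lemma nuD_le: "nuD n a L P \<le> n"
proof -
  have "0 \<in> nuD_sizes n a L P"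
    unfolding nuD_sizes_def by (rule CollectI) (rule exI[of _ "{}"], simp)
  then show ?thesis
    unfolding nuD_eq_Max by (subst Max_le_iff) (auto simp: finite_nuD_sizes dest: nuD_sizes_le)
qed

text \<open>Disjoint edges share neither an agent nor a slice. So \<open>fst\<close> is injective on
  the chosen pairs, its inverse yields the assignment \<phi>, and the assigned tuples differ in
  every coordinate.\<close>

lemma nuD_ge_of_matching:
  assumes LT: "\<forall>i<n. L i P \<subseteq> slice_tuples a"
    and M: "has_matching (agent_edge (length a) ` {(i, j). i < n \<and> j \<in> L i P}) m"
  shows "m \<le> nuD n a L P"
proof -
  let ?E = "agent_edge (length a)" and ?X = "{(i, j). i < n \<and> j \<in> L i P}"
  obtain Y where Y: "Y \<subseteq> ?X" "is_matching (?E ` Y)" "card (?E ` Y) = m"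
    using M unfolding has_matching_def subset_image_iff by blast
  have "Y \<subseteq> {..<n} \<times> slice_tuples a" using Y(1) LT by blast
  then have injE: "inj_on ?E Y" by (rule inj_on_subset[OF inj_on_agent_edge])
  have disj: "?E x \<inter> ?E y = {}" if "x \<in> Y" "y \<in> Y" "x \<noteq> y" for x y
  proof -
    have "?E x \<noteq> ?E y" using injE that by (auto dest: inj_onD)
    then show ?thesis using Y(2) that(1,2) unfolding is_matching_def by simp
  qed
  have injfst: "inj_on fst Y"
  proof (rule inj_onI, rule ccontr)
    fix x y assume xy: "x \<in> Y" "y \<in> Y" "fst x = fst y" "x \<noteq> y"
    then have "(0, fst x) \<in> ?E x \<inter> ?E y" by simp
    then show False using disj xy by blast
  qed
  define \<phi> where "\<phi> q = snd (inv_into Y fst q)" for q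
  have \<phi>: "\<phi> (fst x) = snd x" if "x \<in> Y" for x using injfst that by (simp add: \<phi>_def)
  have "m = card (fst ` Y)" using Y(3) by (simp add: card_image injE injfst)
  moreover have "fst ` Y \<subseteq> {..<n}" using Y(1) by auto
  moreover have "\<forall>q\<in>fst ` Y. \<phi> q \<in> L q P" using \<phi> Y(1) by auto
  moreover have "\<phi> q t \<noteq> \<phi> q' t"
    if q: "q \<in> fst ` Y" "q' \<in> fst ` Y" "q \<noteq> q'" and t: "t < length a" for q q' t
  proof
    assume eq: "\<phi> q t = \<phi> q' t"
    obtain x y where xy: "x \<in> Y" "q = fst x" "y \<in> Y" "q' = fst y" using q by blast
    have "(Suc t, snd x t) \<in> ?E x \<inter> ?E y" using xy \<phi> eq t by simp
    moreover have "x \<noteq> y" using xy q by auto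
    ultimately show False using disj xy by blast
  qed
  ultimately have "m \<in> nuD_sizes n a L P" unfolding nuD_sizes_def by blast
  then show ?thesis unfolding nuD_eq_Max using finite_nuD_sizes by (rule Max_ge[rotated])
qed

section \<open>Boundedness and conclusion\<close>

text \<open>Without some instance \<open>ad_arrow\<close> would hold vacuously for every
  \<open>m\<close>, and the \<open>GREATEST\<close> in \<open>ad\<close> would be meaningless. Every
  cake has a nonempty slice because its lengths sum to 1.\<close>

lemma ad_instance_all_slices:
  assumes pos: "\<forall>t<length a. a ! t > 0"
  shows "ad_instance n a (\<lambda>_ _. slice_tuples a)"
  unfolding ad_instance_def
proof (intro allI impI conjI ballI subset_refl)
  fix P assume P: "P \<in> divisions a"
  have "\<exists>s<a ! t. P t s > 0" if t: "t < length a" for t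
  proof (rule ccontr)
    assume neg: "\<not> ?thesis"
    have "P t s = 0" if "s < a ! t" for s
      using neg P t that unfolding divisions_iff[OF pos] by (metis order_le_less)
    then have "(\<Sum>s<a ! t. P t s) = 0" by simp
    then show False using P t by (simp add: divisions_iff[OF pos])
  qed
  then obtain s where s: "\<forall>t<length a. s t < a ! t \<and> P t (s t) > 0" by metis
  then show "\<exists>j\<in>slice_tuples a. \<forall>t<length a. P t (j t) > 0"
    by (intro bexI[of _ "restrict s {..<length a}"]) (auto simp: slice_tuples_def)
qed simp

lemma ad_arrow_le:
  assumes "\<forall>t<length a. a ! t > 0" and "ad_arrow n a m"
  shows "m \<le> n"
  using assms(2) ad_instance_all_slices[OF assms(1), of n] nuD_le order_trans
  unfolding ad_arrow_def by blast

theorem theorem2p4: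
  fixes n :: nat and a :: "nat list"
  assumes "length a \<ge> 1" and "n > 0" and "\<forall>t<length a. a ! t > 0"
  shows "(\<forall>m. bm_arrow (n # a) m \<longrightarrow> ad_arrow n a m) \<and> bm (n # a) \<le> ad n a"
proof -
  have arrow: "ad_arrow n a m" if bm: "bm_arrow (n # a) m" for m
    unfolding ad_arrow_def
  proof (intro allI impI)
    fix L assume L: "ad_instance n a L"
    obtain P w where P: "P \<in> divisions a" and w: "balanced_weights n a w"
      and supp: "\<forall>i<n. \<forall>j\<in>slice_tuples a. w i j \<noteq> 0 \<longrightarrow> j \<in> L i P"
      by (rule exists_balanced_weights[OF assms(3,2) L])
    have LT: "\<forall>i<n. L i P \<subseteq> slice_tuples a"
      using L P unfolding ad_instance_def by blast
    have "fractionally_balanced (n # a) (agent_side n a)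
        (agent_edge (length a) ` {(i, j). i < n \<and> j \<in> L i P})"
      using LT supp by (intro fractionally_balanced_agent_hypergraph[OF assms(2) w]) auto
    \<comment> \<open>The vertices are pairs here, whereas \<open>bm_arrow\<close> speaks of natural
      numbers; \<open>bm_arrow_any_type\<close> bridges this.\<close>
    then have "m \<le> nuD n a L P"
      using LT by (intro nuD_ge_of_matching bm_arrow_any_type[OF bm])
    then show "\<exists>P\<in>divisions a. m \<le> nuD n a L P" using P by blast
  qed
  \<comment> \<open>The maximum \<open>bm (n # a)\<close> is attained: 0 is a candidate by the empty
    matching, and \<open>arrow\<close> with \<open>ad_arrow_le\<close> bounds all candidates by
    \<open>n\<close>.\<close>
  have "bm_arrow (n # a) 0"
    unfolding bm_arrow_def has_matching_def is_matching_def by (auto intro!: exI[of _ "{}"])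
  then have "bm_arrow (n # a) (bm (n # a))"
    unfolding bm_def by (rule GreatestI_nat) (rule ad_arrow_le[OF assms(3) arrow])
  then have "ad_arrow n a (bm (n # a))" by (rule arrow)
  then have "bm (n # a) \<le> ad n a"
    unfolding ad_def by (rule Greatest_le_nat) (rule ad_arrow_le[OF assms(3)])
  with arrow show ?thesis by blast
qed

end
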